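(* Let $k\ge 1$ be an integer and let $(\mu_n)_{n\ge 0}$, $(K_n)_{n\ge 0}$ be sequences of nonzero real numbers. The solution $(z_n)_{n\ge 0}$ of the higher-order Beverton-Holt equation $$z_{n+k}=\frac{\mu_n K_n z_n}{K_n+(\mu_n-1)z_n},\qquad n\ge 0,$$ with real initial conditions $z_0,\dots,z_{k-1}$ is given in closed form, for all $n\ge 0$ and $j=0,\dots,k-1$, by $$z_{kn+j}=\frac{z_j}{\left(\prod\limits_{k_1=0}^{n-1}\dfrac{1}{\mu_{kk_1+j}}\right)+z_j\sum\limits_{l=0}^{n-1}\left(\dfrac{\mu_{kl+j}-1}{K_{kl+j}\,\mu_{kl+j}}\prod\limits_{k_2=l+1}^{n-1}\dfrac{1}{\mu_{kk_2+j}}\right)},$$ provided the denominators are non-zero.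
   Context: Empty products equal $1$ and empty sums equal $0$. In the Beverton-Holt model one has $\mu_n>1$, $K_n>0$ and positive initial conditions, but the formula is considered for general real parameters and initial conditions. *)

theory Defs
  imports Complex_Main
begin

text \<open>
  Division on \<^typ>\<open>real\<close> is total (\<open>x / 0 = 0\<close>), so a solution of the
  difference equation is required to have non-vanishing denominators: otherwise the
  right-hand side is undefined in the usual sense. The initial conditions are the
  values \<open>z 0, \<dots>, z (k - 1)\<close>, which the predicate leaves free.
\<close>

definition beverton_holt_solution ::
  "nat \<Rightarrow> (nat \<Rightarrow> real) \<Rightarrow> (nat \<Rightarrow> real) \<Rightarrow> (nat \<Rightarrow> real) \<Rightarrow> bool" where
  "beverton_holt_solution k \<mu> K z \<longleftrightarrow>
     (\<forall>n. K n + (\<mu> n - 1) * z n \<noteq> 0 \<and>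
          z (n + k) = \<mu> n * K n * z n / (K n + (\<mu> n - 1) * z n))"

text \<open>
  The denominator of the closed form for the term with index \<open>k * n + j\<close>, where \<open>x\<close>
  is the initial condition belonging to the residue \<open>j\<close>.
\<close>

definition closed_form_denom ::
  "nat \<Rightarrow> (nat \<Rightarrow> real) \<Rightarrow> (nat \<Rightarrow> real) \<Rightarrow> real \<Rightarrow> nat \<Rightarrow> nat \<Rightarrow> real" where
  "closed_form_denom k \<mu> K x n j =
     (\<Prod>k\<^sub>1\<in>{0..<n}. 1 / \<mu> (k * k\<^sub>1 + j)) +
     x * (\<Sum>l\<in>{0..<n}. (\<mu> (k * l + j) - 1) / (K (k * l + j) * \<mu> (k * l + j)) *
            (\<Prod>k\<^sub>2\<in>{l+1..<n}. 1 / \<mu> (k * k\<^sub>2 + j)))"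

end

theory Submission
  imports Defs
begin

text \<open>
  The substitution \<open>z = x / D\<close> linearises the equation. Along the residue class of \<open>j\<close>
  modulo \<open>k\<close>, with \<open>x = z j\<close> and \<open>m = k * n + j\<close>, the denominators \<open>D n\<close> of the closed
  form satisfy the affine recurrence \<open>D (n + 1) = D n / \<mu> m + x * (\<mu> m - 1) / (K m * \<mu> m)\<close>
  with \<open>D 0 = 1\<close>, which is variation of constants (\<open>closed_form_denom_Suc\<close>). When
  \<open>z m = x / D n\<close>, the denominator of the difference equation at \<open>m\<close> is therefore
  \<open>K m * \<mu> m * D (n + 1) / D n\<close>. So it vanishes exactly when \<open>D (n + 1)\<close> does, and
  otherwise the equation produces \<open>x / D (n + 1)\<close> (\<open>step_denom\<close>, \<open>step_value\<close>).

  This makes both directions local in \<open>n\<close>: a solution follows the closed form by induction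
  on \<open>n\<close>, and conversely the closed form at \<open>n\<close> and \<open>n + 1\<close> gives the equation at \<open>m\<close>.
  No division by \<open>x\<close> occurs, so vanishing initial conditions are covered as well.
\<close>

lemma closed_form_denom_0: "closed_form_denom k \<mu> K x 0 j = 1"
  by (simp add: closed_form_denom_def)

text \<open>
  Passing from \<open>n\<close> to \<open>n + 1\<close> multiplies the leading product and every old summand by
  \<open>1 / \<mu> (k * n + j)\<close>; the new summand carries an empty product.
\<close>

lemma closed_form_denom_Suc:
  "closed_form_denom k \<mu> K x (Suc n) j =
     closed_form_denom k \<mu> K x n j / \<mu> (k * n + j) +
     x * ((\<mu> (k * n + j) - 1) / (K (k * n + j) * \<mu> (k * n + j)))"
proof -
  let ?c = "\<lambda>l. (\<mu> (k * l + j) - 1) / (K (k * l + j) * \<mu> (k * l + j))"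
  let ?P = "\<lambda>l n. \<Prod>i\<in>{l+1..<n}. 1 / \<mu> (k * i + j)"
  have "(\<Sum>l\<in>{0..<n}. ?c l * ?P l (Suc n)) = (\<Sum>l\<in>{0..<n}. ?c l * ?P l n) / \<mu> (k * n + j)"
    unfolding sum_divide_distrib by (rule sum.cong) auto
  then have "(\<Sum>l\<in>{0..<Suc n}. ?c l * ?P l (Suc n)) =
      (\<Sum>l\<in>{0..<n}. ?c l * ?P l n) / \<mu> (k * n + j) + ?c n"
    unfolding sum.atLeast0_lessThan_Suc by simp
  then show ?thesis
    unfolding closed_form_denom_def prod.atLeast0_lessThan_Suc
    by (simp only:) (simp add: distrib_left add_divide_distrib)
qed

lemma step_denom:
  fixes \<mu> K x D :: real
  assumes "\<mu> \<noteq> 0" "K \<noteq> 0" "D \<noteq> 0"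
  shows "K + (\<mu> - 1) * (x / D) = K * \<mu> * (D / \<mu> + x * ((\<mu> - 1) / (K * \<mu>))) / D"
  using assms by (simp add: field_simps)

lemma step_value:
  fixes \<mu> K x D :: real
  assumes "\<mu> \<noteq> 0" "K \<noteq> 0" "D \<noteq> 0"
  shows "\<mu> * K * (x / D) / (K + (\<mu> - 1) * (x / D)) = x / (D / \<mu> + x * ((\<mu> - 1) / (K * \<mu>)))"
  unfolding step_denom[OF assms] using assms by simp

theorem mainTheorem1:
  fixes k :: nat and \<mu> K z :: "nat \<Rightarrow> real"
  assumes "k \<ge> 1"
    and "\<And>n. \<mu> n \<noteq> 0"
    and "\<And>n. K n \<noteq> 0"
  shows "beverton_holt_solution k \<mu> K z \<longleftrightarrow>
    (\<forall>n. \<forall>j<k. closed_form_denom k \<mu> K (z j) n j \<noteq> 0 \<and>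
       z (k * n + j) = z j / closed_form_denom k \<mu> K (z j) n j)"
    (is "_ \<longleftrightarrow> (\<forall>n. \<forall>j<k. ?C n j)")
proof -
  let ?D = "\<lambda>n j. closed_form_denom k \<mu> K (z j) n j"
  let ?E = "\<lambda>m. K m + (\<mu> m - 1) * z m \<noteq> 0 \<and>
    z (m + k) = \<mu> m * K m * z m / (K m + (\<mu> m - 1) * z m)"
  have step: "?E (k * n + j) \<longleftrightarrow> ?C (Suc n) j" if C: "?C n j" for n j
  proof -
    let ?m = "k * n + j"
    have D: "?D n j \<noteq> 0" and z: "z ?m = z j / ?D n j"
      using C by auto
    note nz = assms(2)[of ?m] assms(3)[of ?m] D
    have "K ?m + (\<mu> ?m - 1) * z ?m = K ?m * \<mu> ?m * ?D (Suc n) j / ?D n j"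
      unfolding z closed_form_denom_Suc by (rule step_denom[OF nz])
    then have "K ?m + (\<mu> ?m - 1) * z ?m \<noteq> 0 \<longleftrightarrow> ?D (Suc n) j \<noteq> 0"
      using nz by simp
    moreover have "\<mu> ?m * K ?m * z ?m / (K ?m + (\<mu> ?m - 1) * z ?m) = z j / ?D (Suc n) j"
      unfolding z closed_form_denom_Suc by (rule step_value[OF nz])
    moreover have "?m + k = k * Suc n + j"
      by simp
    ultimately show ?thesis
      by metis
  qed
  show ?thesis
  proof
    assume "beverton_holt_solution k \<mu> K z"
    then have E: "?E m" for m
      unfolding beverton_holt_solution_def by blast
    have "?C n j" for n j
    proof (induction n)
      case 0
      show ?case by (simp add: closed_form_denom_0)
    next
      case (Suc n)
      show ?case using step[OF Suc] E by blast
    qed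
    then show "\<forall>n. \<forall>j<k. ?C n j" by blast
  next
    assume C: "\<forall>n. \<forall>j<k. ?C n j"
    have "?E m" for m
    proof -
      have "m mod k < k"
        using assms(1) by simp
      then have "?C (m div k) (m mod k)" "?C (Suc (m div k)) (m mod k)"
        using C by blast+
      then have "?E (k * (m div k) + m mod k)"
        using step by blast
      then show ?thesis
        by simp
    qed
    then show "beverton_holt_solution k \<mu> K z"
      unfolding beverton_holt_solution_def by blast
  qed
qed

end
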